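(* Let $f:\mathbb R^n\to\mathbb R$ be a continuously differentiable function with calm gradient (modulus $L$) which is also pointwise hypomonotone at all $\bar x\in\operatorname{Fix}T_{\rm FB}\subset U_f$ with violation constant $\tau_f$ on $U_f$. Let $g:\mathbb R^n\to\mathbb R\cup\{+\infty\}$ be proper and lower semicontinuous with nonempty subdifferential that is pointwise submonotone at all $v\in S_g'\subset U_g'$ with violation $\tau_g$ on $U_g'$ whenever $z\in\partial g(u)$ for $u\in U_g'$. Let $T_{t,f}U_f\subset U_g$ where $U_g:=\{u+z: u\in U_g',\ z\in\partial g(u)\}$ and let $T_{t,f}\operatorname{Fix}T_{\rm FB}\subset S_g$ where $S_g:=\{v+w: v\in S_g',\ w\in\partial g(v)\}$. If, for all $t\ge0$ small enough, $\Phi_{\rm FB}:=T_{\rm FB}-\mathrm{Id}$ is metrically subregular for $0$ on $U_f$ with modulus $\kappa\le\bar\kappa<1/(2\sqrt{\tau_g})$, then for all $t$ small enough, the forward-backward iteration $x^{k+1}\in T_{\rm FB}x^k$ satisfies $\operatorname{dist}(x^k,\operatorname{Fix}T_{\rm FB})\to0$ at least linearly for all $x^0$ close enough to $\operatorname{Fix}T_{\rm FB}$. In particular, if $g$ is convex, and $\bar\kappa$ is finite, then the distance of the iterates to $\operatorname{Fix}T_{\rm FB}$ converges linearly to zero from any initial point $x^0$ close enough, provided that the stepsize $t$ is sufficiently small.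
   Context: $T_{t,f}:=\mathrm{Id}-t\nabla f$ and $T_{\rm FB}:=\operatorname{prox}_g(\mathrm{Id}-t\nabla f)$, where $t$ is the stepsize and $\operatorname{prox}_g(x)=\operatorname{argmin}_y\{g(y)+\frac12\|y-x\|^2\}$ (set-valued). $\operatorname{Fix}T=\{x: x\in Tx\}$. A mapping applied to a set is the union of the images. $\partial g$ is the limiting subdifferential: $v\in\partial g(\bar x)$ for $\bar x\in\operatorname{dom}g$ if there are $v^k\to v$ and $x^k\to\bar x$ with $g(x^k)\to g(\bar x)$ such that $g(x)\ge g(x^k)+\langle v^k,x-x^k\rangle+o(\|x-x^k\|)$; it is empty outside $\operatorname{dom}g$. The gradient is calm at $\bar x$ with modulus $L$ on $U_f$ if $\|\nabla f(x)-\nabla f(\bar x)\|\le L\|x-\bar x\|$ for all $x\in U_f$. It is pointwise hypomonotone at $\bar x$ with violation constant $\tau_f$ on $U_f$ if $-\tau_f\|x-\bar x\|^2\le\langle\nabla f(x)-\nabla f(\bar x),x-\bar x\rangle$ for all $x\in U_f$. $\partial g$ is pointwise submonotone at $v$ with violation $\tau_g$ on $U_g'$ if $-\tau_g\|(u+z)-(v+w)\|^2\le\langle z-w,u-v\rangle$ for all $w\in\partial g(v)$, $u\in U_g'$, $z\in\partial g(u)$. $\Phi$ is metrically subregular for $0$ on $U$ with constant $\kappa$ if $\operatorname{dist}(x,\Phi^{-1}(0))\le\kappa\operatorname{dist}(0,\Phi(x))$ for all $x\in U$ with $\operatorname{dist}(0,\Phi(x))>0$; the modulus is the smallest such $\kappa$.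 For $\tau_g=0$ the bound $1/(2\sqrt{\tau_g})$ is read as $+\infty$.
   Formalization: Added since the claim fails otherwise: Fix T_FB lies in the interior of U_f and, in the first part, T_FB(U_f) ⊂ U_g'. "Close enough" means an open set containing Fix T_FB, and a uniform distance if U_f contains a tube of constant radius around Fix T_FB. *)

theory Defs
  imports "HOL-Analysis.Analysis" "HOL-Library.Landau_Symbols"
begin

definition edom :: "('a \<Rightarrow> ereal) \<Rightarrow> 'a set" where
  "edom g = {x. g x < \<infinity>}"

definition proper :: "('a \<Rightarrow> ereal) \<Rightarrow> bool" where
  "proper g \<longleftrightarrow> (\<forall>x. g x \<noteq> -\<infinity>) \<and> edom g \<noteq> {}"

definition lower_semicontinuous :: "('a::topological_space \<Rightarrow> ereal) \<Rightarrow> bool" where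
  "lower_semicontinuous g \<longleftrightarrow> (\<forall>x. g x \<le> Liminf (at x) g)"

definition convex_efun :: "('a::real_vector \<Rightarrow> ereal) \<Rightarrow> bool" where
  "convex_efun g \<longleftrightarrow> (\<forall>x y. \<forall>s::real. 0 < s \<longrightarrow> s < 1 \<longrightarrow>
     g ((1 - s) *\<^sub>R x + s *\<^sub>R y) \<le> ereal (1 - s) * g x + ereal s * g y)"

text \<open>The remainder \<open>r\<close> is only constrained near \<open>x\<close>. For \<open>g > -\<infinity>\<close> it can be made as
  negative as necessary elsewhere, so quantifying over all \<open>y\<close> costs nothing.\<close>

definition regular_subdiff :: "('a::euclidean_space \<Rightarrow> ereal) \<Rightarrow> 'a \<Rightarrow> 'a set" where
  "regular_subdiff g x = {v. \<exists>r. r \<in> o[at x](\<lambda>y. norm (y - x)) \<and>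
     (\<forall>y. g x + ereal (v \<bullet> (y - x)) + ereal (r y) \<le> g y)}"

definition limiting_subdiff :: "('a::euclidean_space \<Rightarrow> ereal) \<Rightarrow> 'a \<Rightarrow> 'a set" where
  "limiting_subdiff g x = {v. x \<in> edom g \<and> (\<exists>vs xs. vs \<longlonglongrightarrow> v \<and> xs \<longlonglongrightarrow> x \<and>
     (\<lambda>k. g (xs k)) \<longlonglongrightarrow> g x \<and> (\<forall>k. vs k \<in> regular_subdiff g (xs k)))}"

definition pointwise_submonotone ::
    "('a::real_inner \<Rightarrow> 'a set) \<Rightarrow> 'a \<Rightarrow> real \<Rightarrow> 'a set \<Rightarrow> bool" where
  "pointwise_submonotone F v \<tau> U \<longleftrightarrow> (\<forall>w\<in>F v. \<forall>u\<in>U. \<forall>z\<in>F u.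
     - \<tau> * (norm ((u + z) - (v + w)))\<^sup>2 \<le> (z - w) \<bullet> (u - v))"

definition resolvent_domain :: "('a::plus \<Rightarrow> 'a set) \<Rightarrow> 'a set \<Rightarrow> 'a set" where
  "resolvent_domain F A = {u + z |u z. u \<in> A \<and> z \<in> F u}"

definition calm_at :: "('a::real_normed_vector \<Rightarrow> 'a) \<Rightarrow> 'a \<Rightarrow> real \<Rightarrow> 'a set \<Rightarrow> bool" where
  "calm_at F a L U \<longleftrightarrow> (\<forall>x\<in>U. norm (F x - F a) \<le> L * norm (x - a))"

definition pointwise_hypomonotone ::
    "('a::real_inner \<Rightarrow> 'a) \<Rightarrow> 'a \<Rightarrow> real \<Rightarrow> 'a set \<Rightarrow> bool" where
  "pointwise_hypomonotone F a \<tau> U \<longleftrightarrow>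
     (\<forall>x\<in>U. - \<tau> * (norm (x - a))\<^sup>2 \<le> (F x - F a) \<bullet> (x - a))"

text \<open>In the next definitions \<open>F\<close> is the gradient of the smooth function. The proximal mapping
  carries no stepsize, so \<open>Fix (T_FB F g t)\<close> depends on \<open>t\<close>.\<close>

definition prox :: "('a::real_normed_vector \<Rightarrow> ereal) \<Rightarrow> 'a \<Rightarrow> 'a set" where
  "prox g x = {y. is_arg_min (\<lambda>y. g y + ereal (1 / 2 * (norm (y - x))\<^sup>2)) (\<lambda>_. True) y}"

definition forward_step :: "('a::real_vector \<Rightarrow> 'a) \<Rightarrow> real \<Rightarrow> 'a \<Rightarrow> 'a" where
  "forward_step F t x = x - t *\<^sub>R F x"

definition T_FB ::
    "('a::real_normed_vector \<Rightarrow> 'a) \<Rightarrow> ('a \<Rightarrow> ereal) \<Rightarrow> real \<Rightarrow> 'a \<Rightarrow> 'a set" where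
  "T_FB F g t x = prox g (forward_step F t x)"

definition Phi_FB ::
    "('a::real_normed_vector \<Rightarrow> 'a) \<Rightarrow> ('a \<Rightarrow> ereal) \<Rightarrow> real \<Rightarrow> 'a \<Rightarrow> 'a set" where
  "Phi_FB F g t x = (\<lambda>y. y - x) ` T_FB F g t x"

definition Fix :: "('a \<Rightarrow> 'a set) \<Rightarrow> 'a set" where
  "Fix T = {x. x \<in> T x}"

text \<open>The distance to the empty set is \<open>+\<infinity>\<close> in this theory, whereas \<open>infdist\<close> returns 0.
  Points with \<open>\<Phi> x = {}\<close> impose nothing (right-hand side \<open>+\<infinity>\<close>) and indeed fail
  \<open>0 < infdist 0 (\<Phi> x)\<close>; on the left-hand side nonemptiness is required explicitly.\<close>

definition subregular_const ::
    "('a::real_normed_vector \<Rightarrow> 'b::real_normed_vector set) \<Rightarrow> 'a set \<Rightarrow> real \<Rightarrow> bool" where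
  "subregular_const \<Phi> U \<kappa> \<longleftrightarrow> 0 \<le> \<kappa> \<and> (\<forall>x\<in>U. 0 < infdist 0 (\<Phi> x) \<longrightarrow>
     {y. 0 \<in> \<Phi> y} \<noteq> {} \<and> infdist x {y. 0 \<in> \<Phi> y} \<le> \<kappa> * infdist 0 (\<Phi> x))"

definition subregular_with_modulus ::
    "('a::real_normed_vector \<Rightarrow> 'b::real_normed_vector set) \<Rightarrow> 'a set \<Rightarrow> real \<Rightarrow> bool" where
  "subregular_with_modulus \<Phi> U \<kappa> \<longleftrightarrow>
     subregular_const \<Phi> U \<kappa> \<and> (\<forall>\<kappa>'. subregular_const \<Phi> U \<kappa>' \<longrightarrow> \<kappa> \<le> \<kappa>')"

text \<open>Q-linear convergence, the sense in which ``at least linearly'' is understood; for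
  nonnegative \<open>d\<close> it gives \<open>d k \<le> c ^ k * d 0\<close>, hence convergence to 0.\<close>

definition to_zero_linearly :: "(nat \<Rightarrow> real) \<Rightarrow> bool" where
  "to_zero_linearly d \<longleftrightarrow> (\<exists>c. 0 \<le> c \<and> c < 1 \<and> (\<forall>k. d (Suc k) \<le> c * d k))"

definition linearly_attracted_from :: "('a::metric_space \<Rightarrow> 'a set) \<Rightarrow> 'a set \<Rightarrow> bool" where
  "linearly_attracted_from T V \<longleftrightarrow>
     (\<forall>x. x 0 \<in> V \<and> (\<forall>k. x (Suc k) \<in> T (x k)) \<longrightarrow> to_zero_linearly (\<lambda>k. infdist (x k) (Fix T)))"

text \<open>``For all initial points close enough to \<open>Fix T\<close>'': an open set containing \<open>Fix T\<close> in
  general, and a whole tube of constant radius around \<open>Fix T\<close> as soon as \<open>U\<close>, the set on which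
  the regularity of \<open>T\<close> is known, contains such a tube. The two senses agree for compact \<open>Fix T\<close>;
  otherwise an arbitrary neighbourhood \<open>U\<close> only supports the first one. The tubes are empty,
  not everything, when \<open>Fix T\<close> is empty.\<close>

definition tube :: "'a::metric_space set \<Rightarrow> real \<Rightarrow> 'a set" where
  "tube S \<delta> = (\<Union>y\<in>S. ball y \<delta>)"

definition linearly_attracted_near :: "('a::metric_space \<Rightarrow> 'a set) \<Rightarrow> 'a set \<Rightarrow> bool" where
  "linearly_attracted_near T U \<longleftrightarrow>
     (\<exists>V. open V \<and> Fix T \<subseteq> V \<and> linearly_attracted_from T V) \<and>
     ((\<exists>\<rho>>0. tube (Fix T) \<rho> \<subseteq> U) \<longrightarrow> (\<exists>\<delta>>0. linearly_attracted_from T (tube (Fix T) \<delta>)))"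

end

theory Submission
  imports Defs
begin

text \<open>With \<open>u = x\<^sup>+ - a\<close>, \<open>h = x - x\<^sup>+\<close> and \<open>w = t (\<nabla>f x - \<nabla>f a)\<close>, submonotonicity of \<open>\<partial>g\<close> at a fixed
  point \<open>a\<close> says that \<open>|u|\<^sup>2 + |h - w|\<^sup>2 \<le> (1 + 2 \<tau>\<^sub>g) |x - a - w|\<^sup>2\<close>, where \<open>|w| \<le> t L |x - a|\<close>. Since
  subregularity bounds \<open>|h|\<close> below by \<open>dist x Fix / \<kappa>\<close>, letting \<open>a\<close> approach the projection of \<open>x\<close>
  gives \<open>dist\<^sup>2 x\<^sup>+ Fix \<le> (1 + 2 \<tau>\<^sub>g - 1 / \<kappa>\<^sup>2 + O(t)) dist\<^sup>2 x Fix\<close>. The same inequality bounds the step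
  length by a multiple of \<open>dist x Fix\<close>, so the iterates travel a total distance
  \<open>O(dist x\<^sup>0 Fix)\<close> and never leave \<open>U\<^sub>f\<close>.\<close>

section \<open>Linear convergence from a local contraction and a step bound\<close>

text \<open>Contraction is known only on \<open>U\<close>, so the orbit has to be trapped there. By
  the geometric series, \<open>C / (1 - c)\<close> times the distance to \<open>Fix T\<close> bounds
  all the travel still to come. Adding it to the distance from \<open>a\<close> gives a quantity
  \<open>E\<close> that does not increase along the orbit and stays below the radius of the ball
  inside \<open>U\<close>.\<close>

lemma linear_attraction_in_ball:
  fixes T :: "'a::metric_space \<Rightarrow> 'a set"
  assumes c: "0 \<le> c" "c < 1" and C: "0 \<le> C"
    and contract: "\<And>x y. x \<in> U \<Longrightarrow> y \<in> T x \<Longrightarrow> infdist y (Fix T) \<le> c * infdist x (Fix T)"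
    and step: "\<And>x y. x \<in> U \<Longrightarrow> y \<in> T x \<Longrightarrow> dist y x \<le> C * infdist x (Fix T)"
    and a: "a \<in> Fix T" "ball a ((1 + C / (1 - c)) * \<delta>) \<subseteq> U"
    and x: "x 0 \<in> ball a \<delta>" "\<And>k. x (Suc k) \<in> T (x k)"
  shows "to_zero_linearly (\<lambda>k. infdist (x k) (Fix T))"
proof -
  define E where "E = (\<lambda>y. dist y a + C / (1 - c) * infdist y (Fix T))"
  have q: "0 \<le> C / (1 - c)" using c C by simp
  have U: "y \<in> U" if "E y < (1 + C / (1 - c)) * \<delta>" for y
  proof -
    have "dist y a \<le> E y"
      unfolding E_def using mult_nonneg_nonneg[OF q infdist_nonneg] by simp
    then show ?thesis using that a(2) by (auto simp: dist_commute)
  qed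
  have E_step: "E y \<le> E z" if "z \<in> U" "y \<in> T z" for y z
  proof -
    have "dist y a \<le> dist y z + dist z a" by (rule dist_triangle)
    moreover have "dist y z \<le> C * infdist z (Fix T)" using step that by blast
    moreover have "C / (1 - c) * infdist y (Fix T) \<le> C / (1 - c) * (c * infdist z (Fix T))"
      by (rule mult_left_mono[OF contract[OF that] q])
    \<comment> \<open>The step costs at most \<open>C\<close> times the current distance, which is
      exactly the first term released from the geometric tail.\<close>
    moreover have "C + C / (1 - c) * c = C / (1 - c)" using c by (simp add: field_simps)
    then have "C * infdist z (Fix T) + C / (1 - c) * (c * infdist z (Fix T))
        = C / (1 - c) * infdist z (Fix T)"
      by (metis distrib_right mult.assoc)
    ultimately show ?thesis unfolding E_def by linarith
  qed
  have "E (x k) < (1 + C / (1 - c)) * \<delta>" for k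
  proof (induction k)
    case 0
    have "infdist (x 0) (Fix T) \<le> dist (x 0) a" by (rule infdist_le[OF a(1)])
    then have "E (x 0) \<le> (1 + C / (1 - c)) * dist (x 0) a"
      using mult_left_mono[OF _ q] unfolding E_def by (simp add: distrib_right)
    also have "\<dots> < (1 + C / (1 - c)) * \<delta>"
      using x(1) q by (intro mult_strict_left_mono) (auto simp: dist_commute)
    finally show ?case .
  next
    case (Suc k)
    then show ?case using E_step[OF U x(2)] by fastforce
  qed
  then show ?thesis
    unfolding to_zero_linearly_def using c contract[OF U x(2)] by blast
qed

text \<open>Passing from a ball inside \<open>U\<close> to admissible starting points shrinks the
  radius by a factor \<open>M\<close> that is the same for all fixed points. Radii varying with
  \<open>a\<close> therefore yield the open neighbourhood, and a uniform radius yields the tube.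
  Both neighbourhoods are unions over \<open>Fix T\<close>, so only nonempty \<open>Fix T\<close>
  offers a starting point.\<close>

lemma linear_attraction_near:
  fixes T :: "'a::metric_space \<Rightarrow> 'a set"
  assumes c: "0 \<le> c" "c < 1" and C: "0 \<le> C"
    and contract: "\<And>x y. x \<in> U \<Longrightarrow> y \<in> T x \<Longrightarrow> Fix T \<noteq> {} \<Longrightarrow>
          infdist y (Fix T) \<le> c * infdist x (Fix T)"
    and step: "\<And>x y. x \<in> U \<Longrightarrow> y \<in> T x \<Longrightarrow> Fix T \<noteq> {} \<Longrightarrow> dist y x \<le> C * infdist x (Fix T)"
    and interior: "Fix T \<subseteq> interior U"
  shows "linearly_attracted_near T U"
proof -
  define M where "M = 1 + C / (1 - c)"
  have M: "0 < M" using c C unfolding M_def by (simp add: add_pos_nonneg)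
  have attr: "to_zero_linearly (\<lambda>k. infdist (x k) (Fix T))"
    if "a \<in> Fix T" "ball a r \<subseteq> U" "x 0 \<in> ball a (r / M)" "\<And>k. x (Suc k) \<in> T (x k)" for a r x
  proof (rule linear_attraction_in_ball[where \<delta> = "r / M", OF c C])
    show "ball a ((1 + C / (1 - c)) * (r / M)) \<subseteq> U" using that M by (simp flip: M_def)
  qed (use that contract step in blast)+
  have "\<forall>a\<in>Fix T. \<exists>r>0. ball a r \<subseteq> U"
    using interior by (metis mem_interior subset_iff)
  then obtain r where r: "\<And>a. a \<in> Fix T \<Longrightarrow> 0 < r a" "\<And>a. a \<in> Fix T \<Longrightarrow> ball a (r a) \<subseteq> U"
    by metis
  let ?V = "\<Union>a\<in>Fix T. ball a (r a / M)"
  have "open ?V" "Fix T \<subseteq> ?V" using r M by force+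
  moreover have "linearly_attracted_from T ?V"
    unfolding linearly_attracted_from_def using attr r(2) by blast
  moreover have "\<exists>\<delta>>0. linearly_attracted_from T (tube (Fix T) \<delta>)"
    if "\<rho> > 0" "tube (Fix T) \<rho> \<subseteq> U" for \<rho>
  proof (intro exI conjI)
    show "0 < \<rho> / M" using that M by simp
    have "ball a \<rho> \<subseteq> U" if "a \<in> Fix T" for a
      using \<open>tube (Fix T) \<rho> \<subseteq> U\<close> that unfolding tube_def by blast
    then show "linearly_attracted_from T (tube (Fix T) (\<rho> / M))"
      unfolding linearly_attracted_from_def tube_def using attr by blast
  qed
  ultimately show ?thesis unfolding linearly_attracted_near_def by blast
qed

section \<open>Minimality, closedness and subgradients of the proximal mapping\<close>

lemma prox_le:
  assumes "y \<in> prox g x"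
  shows "g y + ereal (1 / 2 * (norm (y - x))\<^sup>2) \<le> g z + ereal (1 / 2 * (norm (z - x))\<^sup>2)"
  using assms unfolding prox_def is_arg_min_def by (auto simp: not_less)

lemma prox_finite:
  assumes "proper g" "y \<in> prox g x"
  shows "\<bar>g y\<bar> \<noteq> \<infinity>"
proof -
  obtain z where "g z < \<infinity>" using assms(1) unfolding proper_def edom_def by auto
  then show ?thesis
    using assms prox_le[OF assms(2), of z] unfolding proper_def by auto
qed

lemma lower_semicontinuous_le_lim:
  fixes g :: "'a::t1_space \<Rightarrow> ereal"
  assumes lsc: "lower_semicontinuous g" and X: "X \<longlonglongrightarrow> x" and G: "(\<lambda>k. g (X k)) \<longlonglongrightarrow> l"
  shows "g x \<le> l"
proof (rule dense_le)
  fix c assume c: "c < g x"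
  then have "c < Liminf (at x) g" using lsc unfolding lower_semicontinuous_def
    by (meson less_le_trans)
  then have "\<forall>\<^sub>F y in at x. c < g y"
    by (metis less_LiminfD)
  \<comment> \<open>The \<open>Liminf\<close> ignores the centre, which the sequence may hit;
    \<open>c < g x\<close> covers it.\<close>
  then have "\<forall>\<^sub>F y in nhds x. c < g y"
    using c unfolding eventually_at_filter by (auto elim: eventually_mono)
  then have "\<forall>\<^sub>F k in sequentially. c < g (X k)"
    using X by (rule eventually_compose_filterlim)
  then show "c \<le> l"
    by (intro tendsto_lowerbound[OF G]) (auto elim: eventually_mono)
qed

text \<open>Needed so that residual zero, an infimum, is attained and yields a genuine fixed
  point.\<close>

lemma closed_prox:
  assumes "proper g" "lower_semicontinuous g"
  shows "closed (prox g x)"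
  unfolding closed_sequential_limits
proof (intro allI impI)
  fix Y y assume "(\<forall>k. Y k \<in> prox g x) \<and> Y \<longlonglongrightarrow> y"
  then have Y: "\<And>k. Y k \<in> prox g x" "Y \<longlonglongrightarrow> y" by auto
  let ?q = "\<lambda>y. ereal (1 / 2 * (norm (y - x))\<^sup>2)"
  have "g y + ?q y \<le> g z + ?q z" for z
  proof -
    have lim: "(\<lambda>k. ?q (Y k)) \<longlonglongrightarrow> ?q y"
      by (intro tendsto_intros Y(2))
    \<comment> \<open>All minimisers share one objective value. Hence \<open>g (Y k)\<close> is a
      constant minus the quadratic term, so it converges and lower semicontinuity applies to its
      limit.\<close>
    have gk: "g (Y k) = g (Y 0) + ?q (Y 0) - ?q (Y k)" for k
      using prox_le[OF Y(1)[of k], of "Y 0"] prox_le[OF Y(1)[of 0], of "Y k"]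
        prox_finite[OF assms(1) Y(1)[of k]] prox_finite[OF assms(1) Y(1)[of 0]]
      by (cases "g (Y k)"; cases "g (Y 0)") auto
    have "(\<lambda>k. g (Y 0) + ?q (Y 0) - ?q (Y k)) \<longlonglongrightarrow> g (Y 0) + ?q (Y 0) - ?q y"
      by (rule tendsto_diff_ereal[OF _ _ tendsto_const lim])
        (use prox_finite[OF assms(1) Y(1)[of 0]] in auto)
    then have "(\<lambda>k. g (Y k)) \<longlonglongrightarrow> g (Y 0) + ?q (Y 0) - ?q y" by (simp only: gk[symmetric])
    from lower_semicontinuous_le_lim[OF assms(2) Y(2) this]
    have "g y + ?q y \<le> g (Y 0) + ?q (Y 0)"
      using prox_finite[OF assms(1) Y(1)[of 0]] by (cases "g y"; cases "g (Y 0)") auto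
    also have "\<dots> \<le> g z + ?q z" by (rule prox_le[OF Y(1)])
    finally show ?thesis .
  qed
  then show "y \<in> prox g x" unfolding prox_def is_arg_min_def by (auto simp: not_less)
qed

text \<open>Fermat's rule: expanding the square in the minimality inequality around \<open>y\<close>
  leaves the remainder \<open>- (1 / 2 * (norm (z - y))\<^sup>2)\<close>, which is of second order.
  The subgradient is already regular, so constant sequences witness the limiting one.\<close>

lemma diff_prox_in_limiting_subdiff:
  assumes "proper g" "y \<in> prox g x"
  shows "x - y \<in> limiting_subdiff g y"
proof -
  have fin: "\<bar>g y\<bar> \<noteq> \<infinity>" by (rule prox_finite[OF assms])
  let ?r = "\<lambda>z. - (1 / 2 * (norm (z - y))\<^sup>2)"
  have "?r \<in> o[at y](\<lambda>z. norm (z - y))"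
  proof (rule smalloI_tendsto)
    have "((\<lambda>z. - (1 / 2 * norm (z - y))) \<longlongrightarrow> - (1 / 2 * norm (y - y))) (at y)"
      by (intro tendsto_intros)
    moreover have "\<forall>\<^sub>F z in at y. - (1 / 2 * norm (z - y)) = ?r z / norm (z - y)"
      unfolding eventually_at_filter by (auto simp: power2_eq_square)
    ultimately have "((\<lambda>z. ?r z / norm (z - y)) \<longlongrightarrow> - (1 / 2 * norm (y - y))) (at y)"
      by (rule Lim_transform_eventually)
    then show "((\<lambda>z. ?r z / norm (z - y)) \<longlongrightarrow> 0) (at y)" by simp
    show "\<forall>\<^sub>F z in at y. norm (z - y) \<noteq> 0"
      unfolding eventually_at_filter by auto
  qed
  moreover have "g y + ereal ((x - y) \<bullet> (z - y)) + ereal (?r z) \<le> g z" for z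
  proof -
    have "(x - y) \<bullet> (z - y) + ?r z = 1 / 2 * (norm (y - x))\<^sup>2 - 1 / 2 * (norm (z - x))\<^sup>2"
      unfolding power2_norm_eq_inner by (simp add: inner_simps inner_commute field_simps)
    then show ?thesis
      using prox_le[OF assms(2), of z] fin by (cases "g y"; cases "g z") auto
  qed
  ultimately have "x - y \<in> regular_subdiff g y"
    unfolding regular_subdiff_def by blast
  moreover have "y \<in> edom g" using fin unfolding edom_def by auto
  ultimately show ?thesis
    unfolding limiting_subdiff_def
    by (intro CollectI conjI exI[where x = "\<lambda>_. x - y"] exI[where x = "\<lambda>_. y"]) auto
qed

section \<open>Monotonicity of the proximal mapping for convex and for submonotone data\<close>

text \<open>Compare the minimiser \<open>y\<close> with a point of the segment towards
  \<open>z\<close>, divide by the segment parameter \<open>s\<close> and let \<open>s\<close> tend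
  to 0, which removes the quadratic term.\<close>

lemma convex_prox_subgradient:
  fixes g :: "'a::real_inner \<Rightarrow> ereal"
  assumes "proper g" "convex_efun g" "y \<in> prox g x"
  shows "g y + ereal ((x - y) \<bullet> (z - y)) \<le> g z"
proof -
  obtain G where G: "g y = ereal G" using prox_finite[OF assms(1,3)] by (cases "g y") auto
  show ?thesis
  proof (cases "g z")
    case (real H)
    have ineq: "0 \<le> (H - G - (x - y) \<bullet> (z - y)) + s * (1 / 2 * (norm (z - y))\<^sup>2)"
      if s: "0 < s" "s < 1" for s
    proof -
      let ?w = "(1 - s) *\<^sub>R y + s *\<^sub>R z"
      have w: "g ?w \<le> ereal ((1 - s) * G + s * H)"
        using assms(2) s unfolding convex_efun_def by (metis G real plus_ereal.simps(1) times_ereal.simps(1))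
      have "G + 1 / 2 * (norm (y - x))\<^sup>2 \<le> (1 - s) * G + s * H + 1 / 2 * (norm (?w - x))\<^sup>2"
        using prox_le[OF assms(3), of ?w] w G by (cases "g ?w") auto
      moreover have "(norm (?w - x))\<^sup>2 = (norm (y - x))\<^sup>2 - 2 * s * ((x - y) \<bullet> (z - y))
          + s\<^sup>2 * (norm (z - y))\<^sup>2"
        unfolding power2_norm_eq_inner
        by (simp add: inner_simps inner_commute algebra_simps power2_eq_square)
      ultimately have "0 \<le> s * ((H - G - (x - y) \<bullet> (z - y)) + s * (1 / 2 * (norm (z - y))\<^sup>2))"
        by (simp add: algebra_simps power2_eq_square)
      then show ?thesis using s by (simp add: zero_le_mult_iff)
    qed
    have "((\<lambda>s. (H - G - (x - y) \<bullet> (z - y)) + s * (1 / 2 * (norm (z - y))\<^sup>2)) \<longlongrightarrow>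
        (H - G - (x - y) \<bullet> (z - y)) + 0 * (1 / 2 * (norm (z - y))\<^sup>2)) (at_right 0)"
      by (intro tendsto_intros)
    moreover have "\<forall>\<^sub>F s in at_right 0.
        0 \<le> (H - G - (x - y) \<bullet> (z - y)) + s * (1 / 2 * (norm (z - y))\<^sup>2)"
      using ineq by (intro eventually_at_rightI[of 0 1]) auto
    ultimately have "0 \<le> (H - G - (x - y) \<bullet> (z - y)) + 0 * (1 / 2 * (norm (z - y))\<^sup>2)"
      by (rule tendsto_lowerbound) simp
    then show ?thesis using G real by simp
  next
    case MInf
    then show ?thesis using assms(1) unfolding proper_def by auto
  qed simp
qed

text \<open>Add the two subgradient inequalities; the finite values \<open>g y\<close> and
  \<open>g y'\<close> cancel.\<close>

lemma convex_prox_monotone: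
  fixes g :: "'a::real_inner \<Rightarrow> ereal"
  assumes g: "proper g" "convex_efun g" and "y \<in> prox g x" "y' \<in> prox g x'"
  shows "0 \<le> ((x - y) - (x' - y')) \<bullet> (y - y')"
proof -
  have "(x - y) \<bullet> (y' - y) + (x' - y') \<bullet> (y - y') \<le> 0"
    using convex_prox_subgradient[OF g assms(3), of y'] convex_prox_subgradient[OF g assms(4), of y]
      prox_finite[OF g(1) assms(3)] prox_finite[OF g(1) assms(4)]
    by (cases "g y"; cases "g y'") auto
  then show ?thesis by (simp add: inner_simps)
qed

text \<open>A point \<open>a\<close> with \<open>a - t \<nabla>f a = v + w\<close>, \<open>w \<in> \<partial>g v\<close> need not a priori be \<open>v\<close>; submonotonicity
  at \<open>v\<close> forces \<open>-|a - v|\<^sup>2 \<ge> 0\<close>.\<close>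

lemma prox_eq_of_submonotone:
  fixes g :: "'a::euclidean_space \<Rightarrow> ereal"
  assumes "proper g" "a \<in> prox g (v + w)" "a \<in> U" "w \<in> limiting_subdiff g v"
    and "pointwise_submonotone (limiting_subdiff g) v \<tau> U"
  shows "a = v"
proof -
  have "- \<tau> * (norm ((a + (v + w - a)) - (v + w)))\<^sup>2 \<le> ((v + w - a) - w) \<bullet> (a - v)"
    using assms(4,5) assms(3) diff_prox_in_limiting_subdiff[OF assms(1,2)]
    unfolding pointwise_submonotone_def by blast
  then have "(a - v) \<bullet> (a - v) \<le> 0" by (simp add: inner_simps)
  then show ?thesis by (metis inner_gt_zero_iff not_less right_minus_eq)
qed

text \<open>The base point \<open>v\<close> of the decomposition of \<open>z\<close> is
  \<open>a\<close> itself, so submonotonicity holds at \<open>a\<close>. Apply it to the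
  subgradients \<open>z - a\<close> and \<open>x - y\<close>: the sums in its violation term
  collapse to \<open>x\<close> and \<open>z\<close>.\<close>

lemma prox_submonotone:
  fixes g :: "'a::euclidean_space \<Rightarrow> ereal"
  assumes g: "proper g" and a: "a \<in> prox g z" "a \<in> U" and y: "y \<in> prox g x" "y \<in> U"
    and z: "z \<in> resolvent_domain (limiting_subdiff g) S"
    and sub: "\<And>v. v \<in> S \<Longrightarrow> pointwise_submonotone (limiting_subdiff g) v \<tau> U"
  shows "- \<tau> * (norm (x - z))\<^sup>2 \<le> ((x - y) - (z - a)) \<bullet> (y - a)"
proof -
  obtain v w where vw: "v \<in> S" "w \<in> limiting_subdiff g v" "z = v + w"
    using z unfolding resolvent_domain_def by blast
  then have "a = v" using prox_eq_of_submonotone[OF g _ a(2) vw(2) sub] a(1) by blast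
  then have "pointwise_submonotone (limiting_subdiff g) a \<tau> U" using sub vw(1) by blast
  then have "- \<tau> * (norm ((y + (x - y)) - (a + (z - a))))\<^sup>2 \<le> ((x - y) - (z - a)) \<bullet> (y - a)"
    using diff_prox_in_limiting_subdiff[OF g a(1)] diff_prox_in_limiting_subdiff[OF g y(1)] y(2)
    unfolding pointwise_submonotone_def by blast
  then show ?thesis by simp
qed

section \<open>One-step estimate and passage to the distance\<close>

text \<open>\<open>w\<close> stands for the scaled gradient increment. The constants are arranged so
  that for \<open>s\<close> tending to 0 the factors \<open>1 + s\<close> disappear and
  \<open>1 + 2 * \<tau>\<close> remains on the right.\<close>

lemma forward_backward_estimate:
  fixes x y a w :: "'a::real_inner"
  assumes mono: "- \<tau> * (norm (x - a - w))\<^sup>2 \<le> ((x - a - w) - (y - a)) \<bullet> (y - a)"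
    and w: "norm w \<le> s * norm (x - a)" and s: "0 \<le> s" and \<tau>: "0 \<le> \<tau>"
  shows "(norm (y - a))\<^sup>2 + (norm (y - x))\<^sup>2 / (1 + s)
    \<le> ((1 + 2 * \<tau>) * (1 + s)\<^sup>2 + s) * (norm (x - a))\<^sup>2"
proof -
  let ?e = "norm (x - a)" and ?q = "norm (x - y - w)"
  have "norm (x - a - w) \<le> ?e + norm w" by (rule norm_triangle_ineq4)
  also have "\<dots> \<le> (1 + s) * ?e" using w by (simp add: distrib_right)
  finally have *: "(norm (x - a - w))\<^sup>2 \<le> ((1 + s) * ?e)\<^sup>2" by (rule power_mono) simp
  \<comment> \<open>Polarisation: \<open>x - a - w\<close> is the sum of \<open>y - a\<close> and
    \<open>x - y - w\<close>, and \<open>mono\<close> bounds their inner product from below.\<close>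
  have "(norm (x - a - w))\<^sup>2 = (norm (y - a))\<^sup>2 + ?q\<^sup>2 + 2 * (((x - a - w) - (y - a)) \<bullet> (y - a))"
    unfolding power2_norm_eq_inner by (simp add: inner_simps inner_commute)
  with mono have "(norm (y - a))\<^sup>2 + ?q\<^sup>2 \<le> (1 + 2 * \<tau>) * (norm (x - a - w))\<^sup>2"
    by (simp add: distrib_right)
  also have "\<dots> \<le> (1 + 2 * \<tau>) * ((1 + s) * ?e)\<^sup>2"
    using * \<tau> by (intro mult_left_mono) auto
  finally have 1: "(norm (y - a))\<^sup>2 + ?q\<^sup>2 \<le> (1 + 2 * \<tau>) * (1 + s)\<^sup>2 * ?e\<^sup>2"
    by (simp add: power_mult_distrib)
  have "norm (y - x) \<le> ?q + norm w"
    using norm_triangle_ineq[of "x - y - w" w] by (simp add: norm_minus_commute)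
  then have "(norm (y - x))\<^sup>2 \<le> (?q + s * ?e)\<^sup>2" using w by (intro power_mono) auto
  \<comment> \<open>Young's inequality with weight \<open>s\<close>; the defect is
    \<open>s * (?q - ?e)\<^sup>2\<close>.\<close>
  also have "\<dots> \<le> (1 + s) * (?q\<^sup>2 + s * ?e\<^sup>2)"
  proof -
    have "0 \<le> s * (?q - ?e)\<^sup>2" using s by simp
    then show ?thesis by (simp add: power2_eq_square algebra_simps)
  qed
  finally have "(norm (y - x))\<^sup>2 / (1 + s) \<le> ?q\<^sup>2 + s * ?e\<^sup>2"
    using s by (simp add: divide_le_eq mult.commute)
  with 1 show ?thesis by (simp add: distrib_right)
qed

text \<open>Replaces a nearest point of \<open>A\<close>, which need not exist: elements of
  \<open>A\<close> at distance below \<open>d\<close> give the bound for every \<open>d\<close>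
  above the infimum, and \<open>d\<close> then decreases to it.\<close>

lemma le_infdist_squared:
  assumes "A \<noteq> {}" "0 \<le> B" "\<And>a. a \<in> A \<Longrightarrow> R \<le> B * (dist x a)\<^sup>2"
  shows "R \<le> B * (infdist x A)\<^sup>2"
proof -
  have *: "R \<le> B * d\<^sup>2" if d: "infdist x A < d" for d
  proof -
    obtain a where "a \<in> A" "dist x a < d"
      using d cINF_less_iff[OF \<open>A \<noteq> {}\<close> bdd_below_image_dist, of x d]
      unfolding infdist_notempty[OF \<open>A \<noteq> {}\<close>] by blast
    then have "B * (dist x a)\<^sup>2 \<le> B * d\<^sup>2"
      using assms(2) by (intro mult_left_mono power_mono) auto
    with assms(3)[OF \<open>a \<in> A\<close>] show ?thesis by (rule order_trans)
  qed
  have "((\<lambda>d. B * d\<^sup>2) \<longlongrightarrow> B * (infdist x A)\<^sup>2) (at_right (infdist x A))"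
    by (intro tendsto_intros)
  then show ?thesis
    by (rule tendsto_lowerbound) (use * in \<open>auto intro: eventually_mono[OF eventually_at_right_less]\<close>)
qed

section \<open>Metric subregularity and linear attraction\<close>

lemma infdist_fixed_points_le:
  fixes g :: "'a::euclidean_space \<Rightarrow> ereal"
  assumes g: "proper g" "lower_semicontinuous g"
    and sub: "subregular_const (Phi_FB F g t) U \<kappa>" and K: "\<kappa> \<le> K"
    and x: "x \<in> U" and y: "y \<in> T_FB F g t x"
  shows "infdist x (Fix (T_FB F g t)) \<le> K * norm (y - x)"
proof -
  have Fix: "{z. 0 \<in> Phi_FB F g t z} = Fix (T_FB F g t)"
    unfolding Phi_FB_def Fix_def by force
  have yx: "y - x \<in> Phi_FB F g t x" using y unfolding Phi_FB_def by blast
  have \<kappa>: "0 \<le> \<kappa>" using sub unfolding subregular_const_def by blast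
  show ?thesis
  proof (cases "infdist 0 (Phi_FB F g t x) = 0")
    \<comment> \<open>\<open>subregular_const\<close> is silent here. The image is nonempty and
      closed, so it contains 0 and \<open>x\<close> is a fixed point.\<close>
    case True
    have "closed (Phi_FB F g t x)"
      using closed_translation[OF closed_prox[OF g], of "- x"]
      unfolding Phi_FB_def T_FB_def by simp
    then have "x \<in> Fix (T_FB F g t)"
      using True yx in_closed_iff_infdist_zero[of "Phi_FB F g t x" 0] by (auto simp flip: Fix)
    then show ?thesis using \<kappa> K by simp
  next
    case False
    then have "infdist x (Fix (T_FB F g t)) \<le> \<kappa> * infdist 0 (Phi_FB F g t x)"
      using sub x infdist_nonneg[of 0 "Phi_FB F g t x"] unfolding subregular_const_def Fix by auto
    also have "\<dots> \<le> \<kappa> * norm (y - x)"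
      using infdist_le[OF yx, of 0] \<kappa> by (intro mult_left_mono) auto
    also have "\<dots> \<le> K * norm (y - x)" using K by (intro mult_right_mono) auto
    finally show ?thesis .
  qed
qed

text \<open>\<open>mono\<close> is the interface to \<open>g\<close>: submonotonicity supplies it
  with its violation constant, convexity with \<open>\<tau> = 0\<close>. \<open>rate\<close> says
  that the gain from subregularity outweighs the losses from \<open>\<tau>\<close> and from the
  gradient step.\<close>

lemma forward_backward_attraction:
  fixes g :: "'a::euclidean_space \<Rightarrow> ereal"
  assumes g: "proper g" "lower_semicontinuous g"
    and Fix_U: "Fix (T_FB F g t) \<subseteq> interior U"
    and calm: "\<And>a. a \<in> Fix (T_FB F g t) \<Longrightarrow> calm_at F a L U"
    and sub: "subregular_const (Phi_FB F g t) U \<kappa>" "\<kappa> \<le> K" "0 < K"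
    and t: "0 \<le> t" "t * \<bar>L\<bar> \<le> s" and \<tau>: "0 \<le> \<tau>"
    and mono: "\<And>a x y. \<lbrakk>a \<in> Fix (T_FB F g t); x \<in> U; y \<in> T_FB F g t x\<rbrakk> \<Longrightarrow>
        - \<tau> * (norm (forward_step F t x - forward_step F t a))\<^sup>2
          \<le> ((forward_step F t x - y) - (forward_step F t a - a)) \<bullet> (y - a)"
    and rate: "(1 + 2 * \<tau>) * (1 + s)\<^sup>2 + s - 1 / (K\<^sup>2 * (1 + s)) < 1"
  shows "linearly_attracted_near (T_FB F g t) U"
proof -
  let ?T = "T_FB F g t"
  have s: "0 \<le> s" using t by (smt (verit) zero_le_mult_iff)
  define B where "B = (1 + 2 * \<tau>) * (1 + s)\<^sup>2 + s"
  have B: "0 \<le> B" using s \<tau> unfolding B_def by simp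
  have est: "(norm (y - a))\<^sup>2 + (norm (y - x))\<^sup>2 / (1 + s) \<le> B * (dist x a)\<^sup>2"
    if "a \<in> Fix ?T" "x \<in> U" "y \<in> ?T x" for a x y
  proof -
    let ?w = "t *\<^sub>R (F x - F a)"
    have f: "forward_step F t x - forward_step F t a = x - a - ?w"
      unfolding forward_step_def by (simp add: algebra_simps)
    have f': "(forward_step F t x - y) - (forward_step F t a - a) = (x - a - ?w) - (y - a)"
      using f by (simp add: algebra_simps)
    have "norm (F x - F a) \<le> L * norm (x - a)"
      using calm[OF that(1)] that(2) unfolding calm_at_def by blast
    also have "\<dots> \<le> \<bar>L\<bar> * norm (x - a)" by (intro mult_right_mono) auto
    finally have "norm ?w \<le> t * (\<bar>L\<bar> * norm (x - a))" using t(1) by (simp add: mult_left_mono)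
    also have "\<dots> \<le> s * norm (x - a)"
      using t(2) by (simp add: mult_right_mono flip: mult.assoc)
    finally show ?thesis
      using forward_backward_estimate[OF _ _ s \<tau>] mono[OF that] unfolding B_def dist_norm f f' by blast
  qed
  \<comment> \<open>The difference may be negative, hence \<open>max 0\<close>.\<close>
  define c where "c = sqrt (max 0 (B - 1 / (K\<^sup>2 * (1 + s))))"
  have "0 \<le> c" unfolding c_def by simp
  moreover have "c < 1" using rate unfolding c_def B_def by simp
  \<comment> \<open>The step constant comes from \<open>est\<close> by dropping the term
    \<open>(norm (y - a))\<^sup>2\<close>.\<close>
  moreover have "0 \<le> sqrt ((1 + s) * B)" using s B by simp
  moreover have "infdist y (Fix ?T) \<le> c * infdist x (Fix ?T)"
    if x: "x \<in> U" and y: "y \<in> ?T x" and ne: "Fix ?T \<noteq> {}" for x y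
  proof -
    let ?D = "infdist x (Fix ?T)" and ?P = "infdist y (Fix ?T)"
    \<comment> \<open>Subregularity read as a lower bound: the step length is at least
      \<open>?D / K\<close>.\<close>
    have "?D\<^sup>2 \<le> (K * norm (y - x))\<^sup>2"
      using infdist_fixed_points_le[OF g sub(1,2) x y] by (simp add: power_mono infdist_nonneg)
    then have "?D\<^sup>2 / (K\<^sup>2 * (1 + s)) \<le> (norm (y - x))\<^sup>2 / (1 + s)"
      using s sub(3) by (simp add: power_mult_distrib divide_simps mult.commute)
    moreover have "?P\<^sup>2 \<le> (norm (y - a))\<^sup>2" if "a \<in> Fix ?T" for a
      using infdist_le[OF that, of y] by (simp add: dist_norm power_mono infdist_nonneg)
    ultimately have "?P\<^sup>2 + ?D\<^sup>2 / (K\<^sup>2 * (1 + s)) \<le> B * (dist x a)\<^sup>2" if "a \<in> Fix ?T" for a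
      using est[OF that x y] that by fastforce
    \<comment> \<open>The left side no longer depends on \<open>a\<close>, so the infimum over fixed
      points can be taken on the right.\<close>
    from le_infdist_squared[OF ne B this]
    have "?P\<^sup>2 \<le> (B - 1 / (K\<^sup>2 * (1 + s))) * ?D\<^sup>2" by (simp add: left_diff_distrib)
    also have "\<dots> \<le> max 0 (B - 1 / (K\<^sup>2 * (1 + s))) * ?D\<^sup>2" by (intro mult_right_mono) auto
    also have "\<dots> = (c * ?D)\<^sup>2" unfolding c_def by (simp add: power_mult_distrib)
    finally show ?thesis
      by (rule power2_le_imp_le) (use \<open>0 \<le> c\<close> in \<open>simp add: infdist_nonneg\<close>)
  qed
  moreover have "dist y x \<le> sqrt ((1 + s) * B) * infdist x (Fix ?T)"
    if x: "x \<in> U" and y: "y \<in> ?T x" and ne: "Fix ?T \<noteq> {}" for x y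
  proof -
    have "(norm (y - x))\<^sup>2 / (1 + s) \<le> B * (dist x a)\<^sup>2" if "a \<in> Fix ?T" for a
      using est[OF that x y] by (smt (verit) zero_le_power2)
    from le_infdist_squared[OF ne B this]
    have "(norm (y - x))\<^sup>2 \<le> (1 + s) * B * (infdist x (Fix ?T))\<^sup>2"
      using s by (simp add: divide_le_eq mult_ac)
    also have "\<dots> = (sqrt ((1 + s) * B) * infdist x (Fix ?T))\<^sup>2"
      using s B by (simp add: power_mult_distrib)
    finally show ?thesis
      unfolding dist_norm by (rule power2_le_imp_le) (use s B in \<open>simp add: infdist_nonneg\<close>)
  qed
  ultimately show ?thesis using Fix_U by (rule linear_attraction_near)
qed

section \<open>Choice of the stepsize and conclusion\<close>

text \<open>At \<open>s = 0\<close> the expression is \<open>1 + 2 * \<tau> - 1 / K\<^sup>2\<close>,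
  which is below 1 by assumption; continuity does the rest.\<close>

lemma exists_small_rate:
  fixes K \<tau> :: real
  assumes "0 < K" "2 * \<tau> * K\<^sup>2 < 1"
  shows "\<exists>s>0. (1 + 2 * \<tau>) * (1 + s)\<^sup>2 + s - 1 / (K\<^sup>2 * (1 + s)) < 1"
proof -
  let ?r = "\<lambda>s. (1 + 2 * \<tau>) * (1 + s)\<^sup>2 + s - 1 / (K\<^sup>2 * (1 + s))"
  have "(?r \<longlongrightarrow> ?r 0) (at_right 0)"
    using assms by (intro tendsto_intros) auto
  moreover have "?r 0 < 1" using assms by (simp add: field_simps)
  ultimately have "\<forall>\<^sub>F s in at_right 0. ?r s < 1" by (rule order_tendstoD(2))
  then obtain b where b: "b > 0" "\<And>s. s > 0 \<Longrightarrow> s < b \<Longrightarrow> ?r s < 1"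
    unfolding eventually_at_right_field by auto
  from b(2)[of "b / 2"] b(1) show ?thesis by (intro exI[of _ "b / 2"]) auto
qed

theorem theorem3p3:
  fixes f :: "real ^ 'n \<Rightarrow> real"
    and grad_f :: "real ^ 'n \<Rightarrow> real ^ 'n"
    and g :: "real ^ 'n \<Rightarrow> ereal"
    and U\<^sub>f U\<^sub>g' S\<^sub>g' :: "(real ^ 'n) set"
    and L \<tau>\<^sub>f \<tau>\<^sub>g t\<^sub>0 :: real
    and \<kappa>bar :: ereal
  assumes gradient: "\<And>x. GDERIV f x :> grad_f x"
    and C1: "continuous_on UNIV grad_f"
    and g: "proper g" "lower_semicontinuous g"
    and t0: "0 < t\<^sub>0"
    and Fix_U\<^sub>f: "\<And>t. t \<in> {0..t\<^sub>0} \<Longrightarrow> Fix (T_FB grad_f g t) \<subseteq> interior U\<^sub>f"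
    and calm: "\<And>t x. \<lbrakk>t \<in> {0..t\<^sub>0}; x \<in> Fix (T_FB grad_f g t)\<rbrakk> \<Longrightarrow> calm_at grad_f x L U\<^sub>f"
    and hypomonotone: "\<And>t x. \<lbrakk>t \<in> {0..t\<^sub>0}; x \<in> Fix (T_FB grad_f g t)\<rbrakk>
          \<Longrightarrow> pointwise_hypomonotone grad_f x \<tau>\<^sub>f U\<^sub>f"
    and subregular: "\<And>t. t \<in> {0..t\<^sub>0}
          \<Longrightarrow> \<exists>\<kappa>. subregular_with_modulus (Phi_FB grad_f g t) U\<^sub>f \<kappa> \<and> ereal \<kappa> \<le> \<kappa>bar"
  shows "(S\<^sub>g' \<subseteq> U\<^sub>g' \<and> 0 \<le> \<tau>\<^sub>g \<and>
          (\<forall>v\<in>S\<^sub>g'. limiting_subdiff g v \<noteq> {} \<and>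
                    pointwise_submonotone (limiting_subdiff g) v \<tau>\<^sub>g U\<^sub>g') \<and>
          (\<forall>t\<in>{0..t\<^sub>0}.
             forward_step grad_f t ` U\<^sub>f \<subseteq> resolvent_domain (limiting_subdiff g) U\<^sub>g' \<and>
             forward_step grad_f t ` Fix (T_FB grad_f g t)
               \<subseteq> resolvent_domain (limiting_subdiff g) S\<^sub>g' \<and>
             (\<Union>x\<in>U\<^sub>f. T_FB grad_f g t x) \<subseteq> U\<^sub>g') \<and>
          \<kappa>bar < 1 / ereal (2 * sqrt \<tau>\<^sub>g)
          \<longrightarrow> (\<exists>t\<^sub>1>0. \<forall>t\<in>{0..t\<^sub>1}. linearly_attracted_near (T_FB grad_f g t) U\<^sub>f))
       \<and> (convex_efun g \<and> \<kappa>bar < \<infinity>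
          \<longrightarrow> (\<exists>t\<^sub>1>0. \<forall>t\<in>{0..t\<^sub>1}. linearly_attracted_near (T_FB grad_f g t) U\<^sub>f))"
proof -
  let ?T = "T_FB grad_f g"
  let ?near = "\<exists>t\<^sub>1>0. \<forall>t\<in>{0..t\<^sub>1}. linearly_attracted_near (?T t) U\<^sub>f"
  have attraction: ?near
    if \<tau>: "0 \<le> \<tau>" and K: "0 < K" "2 * \<tau> * K\<^sup>2 < 1" "\<kappa>bar \<le> ereal K"
      and mono: "\<And>t a x y. \<lbrakk>t \<in> {0..t\<^sub>0}; a \<in> Fix (?T t); x \<in> U\<^sub>f; y \<in> ?T t x\<rbrakk> \<Longrightarrow>
        - \<tau> * (norm (forward_step grad_f t x - forward_step grad_f t a))\<^sup>2
          \<le> ((forward_step grad_f t x - y) - (forward_step grad_f t a - a)) \<bullet> (y - a)"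
    for \<tau> K :: real
  proof -
    obtain s where s: "s > 0" "(1 + 2 * \<tau>) * (1 + s)\<^sup>2 + s - 1 / (K\<^sup>2 * (1 + s)) < 1"
      using exists_small_rate[OF K(1,2)] by blast
    \<comment> \<open>\<open>K\<close> and \<open>s\<close> do not depend on \<open>t\<close>, so
      one threshold serves all stepsizes. The denominator \<open>1 + \<bar>L\<bar>\<close> is
      positive even for \<open>L = 0\<close>.\<close>
    define t\<^sub>1 where "t\<^sub>1 = min t\<^sub>0 (s / (1 + \<bar>L\<bar>))"
    have "linearly_attracted_near (?T t) U\<^sub>f" if "t \<in> {0..t\<^sub>1}" for t
    proof -
      have t: "t \<in> {0..t\<^sub>0}" "0 \<le> t" "t * (1 + \<bar>L\<bar>) \<le> s"
        using that unfolding t\<^sub>1_def by (auto simp: le_divide_eq)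
      then have tL: "t * \<bar>L\<bar> \<le> s" by (simp add: distrib_left)
      obtain \<kappa> where "subregular_const (Phi_FB grad_f g t) U\<^sub>f \<kappa>" "ereal \<kappa> \<le> \<kappa>bar"
        using subregular[OF t(1)] unfolding subregular_with_modulus_def by blast
      moreover from this have "\<kappa> \<le> K" using K(3) by (metis ereal_less_eq(3) order_trans)
      ultimately show ?thesis
        using forward_backward_attraction[OF g Fix_U\<^sub>f[OF t(1)] calm[OF t(1)] _ _ K(1) t(2) tL \<tau>
            mono[OF t(1)] s(2)] by blast
    qed
    moreover have "0 < t\<^sub>1" using t0 s(1) unfolding t\<^sub>1_def by (simp add: add_pos_nonneg)
    ultimately show ?thesis by blast
  qed
  \<comment> \<open>The modulus at \<open>t = 0\<close> is nonnegative; thus every real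
    \<open>K\<close> strictly above \<open>\<kappa>bar\<close> is positive.\<close>
  have "0 \<le> \<kappa>bar"
  proof -
    obtain \<kappa> where "0 \<le> \<kappa>" "ereal \<kappa> \<le> \<kappa>bar"
      using subregular[of 0] t0 unfolding subregular_with_modulus_def subregular_const_def by auto
    then show ?thesis by (metis ereal_less_eq(5) order_trans)
  qed
  show ?thesis
  proof (intro conjI impI; elim conjE)
    assume \<tau>: "0 \<le> \<tau>\<^sub>g"
      and sub: "\<forall>v\<in>S\<^sub>g'. limiting_subdiff g v \<noteq> {} \<and>
                    pointwise_submonotone (limiting_subdiff g) v \<tau>\<^sub>g U\<^sub>g'"
      and dom: "\<forall>t\<in>{0..t\<^sub>0}.
             forward_step grad_f t ` U\<^sub>f \<subseteq> resolvent_domain (limiting_subdiff g) U\<^sub>g' \<and>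
             forward_step grad_f t ` Fix (T_FB grad_f g t)
               \<subseteq> resolvent_domain (limiting_subdiff g) S\<^sub>g' \<and>
             (\<Union>x\<in>U\<^sub>f. T_FB grad_f g t x) \<subseteq> U\<^sub>g'"
      and less: "\<kappa>bar < 1 / ereal (2 * sqrt \<tau>\<^sub>g)"
    obtain K where K: "\<kappa>bar < ereal K" "ereal K < 1 / ereal (2 * sqrt \<tau>\<^sub>g)"
      using ereal_dense2[OF less] by blast
    have "0 < K" using K(1) \<open>0 \<le> \<kappa>bar\<close> by (metis ereal_less(2) le_less_trans)
    moreover have "2 * \<tau>\<^sub>g * K\<^sup>2 < 1"
    \<comment> \<open>Squaring \<open>K < 1 / (2 * sqrt \<tau>\<^sub>g)\<close> gives
      \<open>4 * (\<tau>\<^sub>g * K\<^sup>2) < 1\<close>; for \<open>\<tau>\<^sub>g = 0\<close> the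
      claim is \<open>0 < 1\<close>.\<close>
    proof (cases "\<tau>\<^sub>g = 0")
      case False
      then have pos: "0 < 2 * sqrt \<tau>\<^sub>g" using \<tau> by simp
      then have "1 / ereal (2 * sqrt \<tau>\<^sub>g) = ereal (1 / (2 * sqrt \<tau>\<^sub>g))"
        by (simp add: one_ereal_def)
      then have "K < 1 / (2 * sqrt \<tau>\<^sub>g)" using K(2) by simp
      then have "K * (2 * sqrt \<tau>\<^sub>g) < 1" using pos by (simp add: less_divide_eq)
      then have "(K * (2 * sqrt \<tau>\<^sub>g))\<^sup>2 < 1"
        using \<open>0 < K\<close> pos by (simp add: power_less_one_iff)
      then have "4 * (\<tau>\<^sub>g * K\<^sup>2) < 1" using \<tau> by (simp add: power_mult_distrib mult_ac)
      moreover have "0 \<le> \<tau>\<^sub>g * K\<^sup>2" using \<tau> by simp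
      ultimately show ?thesis by linarith
    qed simp
    moreover have "- \<tau>\<^sub>g * (norm (forward_step grad_f t x - forward_step grad_f t a))\<^sup>2
          \<le> ((forward_step grad_f t x - y) - (forward_step grad_f t a - a)) \<bullet> (y - a)"
      if "t \<in> {0..t\<^sub>0}" "a \<in> Fix (?T t)" "x \<in> U\<^sub>f" "y \<in> ?T t x" for t a x y
    proof (rule prox_submonotone[OF g(1)])
      have a: "a \<in> U\<^sub>f" "a \<in> ?T t a"
        using Fix_U\<^sub>f[OF that(1)] that(2) interior_subset unfolding Fix_def by auto
      show "a \<in> prox g (forward_step grad_f t a)" "y \<in> prox g (forward_step grad_f t x)"
        using a that(4) unfolding T_FB_def by auto
      \<comment> \<open>Both are proximal images of points of \<open>U\<^sub>f\<close>, since fixed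
        points lie in its interior.\<close>
      show "a \<in> U\<^sub>g'" "y \<in> U\<^sub>g'" using dom that a by blast+
      show "forward_step grad_f t a \<in> resolvent_domain (limiting_subdiff g) S\<^sub>g'"
        using dom that by blast
    qed (use sub in blast)
    ultimately show ?near using attraction[OF \<tau>] K(1) by (meson less_imp_le)
  next
    assume cvx: "convex_efun g" and "\<kappa>bar < \<infinity>"
    then obtain k where k: "\<kappa>bar = ereal k" using \<open>0 \<le> \<kappa>bar\<close> by (cases \<kappa>bar) auto
    have "0 \<le> ((forward_step grad_f t x - y) - (forward_step grad_f t a - a)) \<bullet> (y - a)"
      if "a \<in> Fix (?T t)" "y \<in> ?T t x" for t a x y
      using convex_prox_monotone[OF g(1) cvx] that unfolding Fix_def T_FB_def by blast
    \<comment> \<open>With \<open>\<tau> = 0\<close> any positive real bound on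
      \<open>\<kappa>bar\<close> is admissible; adding 1 secures positivity when
      \<open>k = 0\<close>.\<close>
    then show ?near
      using attraction[of 0 "k + 1"] k \<open>0 \<le> \<kappa>bar\<close> by simp
  qed
qed

end
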